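(* Let $\lambda>0$ and $\beta\in(0,1]$. The Appell polynomials $A_n^{\lambda,\beta}$, $n\in\mathbb{N}$, generated by the fractional Poisson measure $\pi_{\lambda,\beta}$ are given for any $x\in\mathbb{R}$ in terms of the Bell polynomials as $$A_n^{\lambda,\beta}(x)=\sum_{k=0}^n\binom{n}{k}\Bigg[\sum_{i=0}^{n-k}(-1)^i\,i!\,B_{n-k,i}\big(M_{\lambda,\beta}(1),\dots,M_{\lambda,\beta}(n-k-i+1)\big)\Bigg]x^k.$$
   Context: The Mittag-Leffler function is $E_\beta(z)=\sum_{n=0}^\infty \frac{z^n}{\Gamma(\beta n+1)}$. The fractional Poisson measure $\pi_{\lambda,\beta}$ is the probability measure on $\mathbb{R}$ concentrated on $\mathbb{N}_0=\{0,1,2,\dots\}$ with $\pi_{\lambda,\beta}(\{k\})=\frac{\lambda^k}{k!}E_\beta^{(k)}(-\lambda)$; its Laplace transform is $l_{\pi_{\lambda,\beta}}(z)=\int_{\mathbb{R}}e^{zx}\,\mathrm{d}\pi_{\lambda,\beta}(x)=E_\beta(\lambda(e^z-1))$. Its moments are $M_{\lambda,\beta}(n)=\int_{\mathbb{R}}x^n\,\mathrm{d}\pi_{\lambda,\beta}(x)=\frac{\mathrm{d}^n}{\mathrm{d}z^n}l_{\pi_{\lambda,\beta}}(z)\big|_{z=0}$. The Appell polynomials $A_n^{\lambda,\beta}$ are defined by $\frac{e^{zx}}{E_\beta(\lambda(e^z-1))}=\sum_{n=0}^\infty\frac{z^n}{n!}A_n^{\lambda,\beta}(x)$ for $z$ in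 a neighborhood of $0\in\mathbb{C}$. The (partial) Bell polynomials are, for integers $0\le k\le n$, $$B_{n,k}(x_1,\dots,x_{n-k+1})=\sum\frac{n!}{j_1!\cdots j_{n-k+1}!}\left(\frac{x_1}{1!}\right)^{j_1}\cdots\left(\frac{x_{n-k+1}}{(n-k+1)!}\right)^{j_{n-k+1}},$$ the sum being over all non-negative integers $j_1,\dots,j_{n-k+1}$ with $j_1+\dots+j_{n-k+1}=k$ and $j_1+2j_2+\dots+(n-k+1)j_{n-k+1}=n$. *)

theory Defs
  imports "HOL-Probability.Probability"
begin

definition mittag_leffler :: "real \<Rightarrow> 'a \<Rightarrow> 'a::{banach, real_normed_field}" where
  "mittag_leffler \<beta> z = (\<Sum>n. z ^ n / of_real (Gamma (\<beta> * real n + 1)))"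

(* For 0 < lam and 0 < \<beta> \<le> 1 the weights are nonnegative (complete monotonicity of
   x \<mapsto> mittag_leffler \<beta> (- x)), so ennreal does not truncate them. *)
definition frac_poisson :: "real \<Rightarrow> real \<Rightarrow> real measure" where
  "frac_poisson lam \<beta> =
     distr (density (count_space UNIV)
              (\<lambda>k::nat. ennreal (lam ^ k / fact k * (deriv ^^ k) (mittag_leffler \<beta>) (- lam))))
           borel real"

definition frac_poisson_moment :: "real \<Rightarrow> real \<Rightarrow> nat \<Rightarrow> real" where
  "frac_poisson_moment lam \<beta> n = (LINT t | frac_poisson lam \<beta>. t ^ n)"

definition appell :: "real \<Rightarrow> real \<Rightarrow> nat \<Rightarrow> real \<Rightarrow> real" where
  "appell lam \<beta> n x =
     (THE a :: nat \<Rightarrow> real. \<forall>\<^sub>F z :: complex in nhds 0.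
        (\<lambda>m. z ^ m / fact m * of_real (a m)) sums
        (exp (z * of_real x) / mittag_leffler \<beta> (of_real lam * (exp z - 1)))) n"

(* Meant for k \<le> n. Only the arguments x 1, ..., x (n - k + 1) are used; extensional
   functions on {1..n - k + 1} represent the tuples of exponents. The constraint on the
   sum of the exponents makes the index set finite. *)
definition bell_poly :: "nat \<Rightarrow> nat \<Rightarrow> (nat \<Rightarrow> real) \<Rightarrow> real" where
  "bell_poly n k x =
     (\<Sum>j | j \<in> {1..n - k + 1} \<rightarrow>\<^sub>E (UNIV :: nat set) \<and>
             (\<Sum>i = 1..n - k + 1. j i) = k \<and> (\<Sum>i = 1..n - k + 1. i * j i) = n.
        fact n / (\<Prod>i = 1..n - k + 1. fact (j i)) *
        (\<Prod>i = 1..n - k + 1. (x i / fact i) ^ j i))"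

end

theory Submission
  imports Defs "HOL-Complex_Analysis.Complex_Analysis" "HOL-Real_Asymp.Real_Asymp"
begin

text \<open>
  Write \<open>l z = E\<^sub>\<beta> (\<lambda> (exp z - 1))\<close>. Its Taylor coefficients at 0 are \<open>M n / n!\<close>, and the coefficients
  of \<open>1 / l = \<Sum>i. (1 - l) ^ i\<close> are read off from \<open>(l - 1) ^ i / i!\<close>, the exponential generating
  function of the Bell polynomials \<open>B n i\<close> in the moments; multiplying by \<open>exp (z x)\<close> gives the claim.

  That the moments are those Taylor coefficients requires the weights of \<open>frac_poisson\<close> to be
  nonnegative, i.e. \<open>E\<^sub>\<beta>\<^sup>(\<^sup>k\<^sup>) (-r) \<ge> 0\<close> for \<open>r \<ge> 0\<close>. By Euler's product, \<open>1 / \<Gamma> (\<beta> n + 1)\<close> is the decreasing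
  limit of \<open>(\<beta> n + 1) \<dots> (\<beta> n + N) / (N! N powr (\<beta> n))\<close> as \<open>N \<rightarrow> \<infinity>\<close>. The numerator is a nonnegative
  combination of the binomial coefficients \<open>(n + j) choose j\<close>, so the approximating power series are
  nonnegative combinations of the functions \<open>(1 - z / N powr \<beta>) ^ (-j-1)\<close>, all of whose derivatives
  are nonnegative.
\<close>

section \<open>Bell polynomials as coefficients of powers of a power series\<close>

lemma finite_PiE_sum_eq:
  assumes "finite S"
  shows "finite {j \<in> S \<rightarrow>\<^sub>E (UNIV :: nat set). (\<Sum>l\<in>S. j l) = i}"
proof (rule finite_subset)
  show "{j \<in> S \<rightarrow>\<^sub>E (UNIV :: nat set). (\<Sum>l\<in>S. j l) = i} \<subseteq> S \<rightarrow>\<^sub>E {..i}"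
  proof clarify
    fix j assume "j \<in> S \<rightarrow>\<^sub>E (UNIV :: nat set)"
    moreover have "j l \<le> (\<Sum>l\<in>S. j l)" if "l \<in> S" for l
      using that assms by (intro member_le_sum) auto
    ultimately show "j \<in> S \<rightarrow>\<^sub>E {..\<Sum>l\<in>S. j l}" by (simp add: PiE_iff)
  qed
  show "finite (S \<rightarrow>\<^sub>E {..i})"
    using assms by (intro finite_PiE) auto
qed

text \<open>Division by \<open>fact i\<close> turns the binomial theorem into a plain convolution of
  divided powers. In the induction on \<open>S\<close>, the exponent of the new element
  \<open>a\<close> is split off, and pairs \<open>(k, j)\<close> correspond to the tuples
  \<open>j(a := k)\<close>.\<close>

lemma fps_multinomial:
  fixes g :: "'b \<Rightarrow> 'a :: field_char_0 fps"
  assumes "finite S"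
  shows "fps_const (1 / fact i) * (\<Sum>l\<in>S. g l) ^ i =
    (\<Sum>j | j \<in> S \<rightarrow>\<^sub>E (UNIV :: nat set) \<and> (\<Sum>l\<in>S. j l) = i.
       \<Prod>l\<in>S. fps_const (1 / fact (j l)) * g l ^ j l)"
  using assms
proof (induction S arbitrary: i rule: finite_induct)
  case empty
  then show ?case by (cases i) auto
next
  case (insert a S)
  define J where "J T i = {j \<in> T \<rightarrow>\<^sub>E (UNIV :: nat set). (\<Sum>l\<in>T. j l) = i}" for T :: "'b set" and i
  define d where "d l k = fps_const (1 / fact k) * g l ^ k" for l k
  have fin: "finite (J S k)" for k
    unfolding J_def by (rule finite_PiE_sum_eq[OF insert(1)])
  have "fps_const (1 / fact i) * (\<Sum>l\<in>insert a S. g l) ^ i =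
        (\<Sum>k\<le>i. d a k * (fps_const (1 / fact (i - k)) * (\<Sum>l\<in>S. g l) ^ (i - k)))"
  proof -
    have "fps_const (1 / fact i) * (of_nat (i choose k) * x * y) =
          fps_const (1 / fact k) * x * (fps_const (1 / fact (i - k)) * y)"
      if "k \<in> {..i}" for k and x y :: "'a fps"
    proof -
      have "fps_const (1 / fact i) * of_nat (i choose k) =
            (fps_const (1 / fact k) * fps_const (1 / fact (i - k)) :: 'a fps)"
        using that by (simp add: fps_of_nat[symmetric] binomial_fact field_simps)
      then show ?thesis by (simp only: mult.assoc[symmetric]) (simp only: mult_ac)
    qed
    then show ?thesis
      unfolding sum.insert[OF insert(1,2)] binomial_ring sum_distrib_left d_def
      by (intro sum.cong refl)
  qed
  also have "\<dots> = (\<Sum>k\<le>i. \<Sum>j\<in>J S (i - k). d a k * (\<Prod>l\<in>S. d l (j l)))"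
    using insert.IH by (simp add: J_def d_def sum_distrib_left)
  also have "\<dots> = (\<Sum>(k,j)\<in>(SIGMA k:{..i}. J S (i - k)). d a k * (\<Prod>l\<in>S. d l (j l)))"
    using fin by (simp add: sum.Sigma)
  also have "\<dots> = (\<Sum>j\<in>J (insert a S) i. \<Prod>l\<in>insert a S. d l (j l))"
  proof (rule sum.reindex_bij_witness
      [of _ "\<lambda>j. (j a, restrict j S)" "\<lambda>(k,j). j(a := k)"], goal_cases)
    case (1 p)
    then show ?case using insert(2)
      by (auto simp: J_def PiE_iff extensional_def restrict_def fun_eq_iff)
  next
    case (2 p)
    then obtain k j where p: "p = (k, j)" "k \<le> i" "j \<in> J S (i - k)" by auto
    have "(\<Sum>l\<in>S. (j(a := k)) l) = (\<Sum>l\<in>S. j l)"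
      using insert(2) by (intro sum.cong) auto
    then show ?case
      using p insert(1,2) by (simp add: J_def) (auto simp: PiE_iff extensional_def)
  next
    case (3 j)
    then show ?case using insert(2)
      by (auto simp: J_def PiE_iff extensional_def restrict_def fun_eq_iff)
  next
    case (4 j)
    then show ?case using insert(1,2)
      by (auto simp: J_def PiE_iff extensional_def)
  next
    case (5 p)
    then obtain k j where p: "p = (k, j)" by auto
    have "(\<Prod>l\<in>S. d l ((j(a := k)) l)) = (\<Prod>l\<in>S. d l (j l))"
      using insert(2) by (intro prod.cong) auto
    then show ?case
      using p insert(1,2) by simp
  qed
  finally show ?case by (simp add: J_def d_def)
qed

lemma fps_power_nth_cong:
  fixes f g :: "'a :: comm_semiring_1 fps"
  assumes "\<And>k. k \<le> n \<Longrightarrow> f $ k = g $ k"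
  shows "(f ^ i) $ n = (g ^ i) $ n"
  using assms
proof (induction i arbitrary: n)
  case (Suc i)
  then show ?case by (auto simp: fps_mult_nth intro!: sum.cong)
qed auto

text \<open>Since \<open>H = fps_X * H1\<close>, coefficient \<open>m\<close> of
  \<open>H ^ i\<close> is coefficient \<open>m - i\<close> of \<open>H1 ^ i\<close>. It involves
  only \<open>x 1\<close>, ..., \<open>x (m - i + 1)\<close>, so \<open>H\<close> may be replaced by
  the polynomial \<open>T\<close>, to which the multinomial theorem applies.\<close>

lemma fps_power_nth_eq_bell_poly:
  fixes x :: "nat \<Rightarrow> real"
  defines "H \<equiv> Abs_fps (\<lambda>m. if m = 0 then 0 else x m / fact m)"
  assumes "i \<le> m"
  shows "(H ^ i) $ m = fact i / fact m * bell_poly m i x"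
proof -
  define S where "S = {1..m - i + 1}"
  define H1 where "H1 = Abs_fps (\<lambda>k. x (Suc k) / fact (Suc k))"
  define T1 where "T1 = Abs_fps (\<lambda>k. if k \<le> m - i then x (Suc k) / fact (Suc k) else 0)"
  define T where "T = (\<Sum>l\<in>S. fps_const (x l / fact l) * fps_X ^ l)"
  have H: "H = fps_X * H1"
    by (rule fps_ext) (auto simp: H_def H1_def simp del: fact_Suc)
  have T: "T = fps_X * T1"
  proof (rule fps_ext)
    fix n
    show "T $ n = (fps_X * T1) $ n"
      by (cases n) (auto simp: T_def T1_def S_def fps_sum_nth if_distrib cong: if_cong simp del: fact_Suc)
  qed
  have "(H ^ i) $ m = (H1 ^ i) $ (m - i)"
    using assms(2) by (simp add: H power_mult_distrib fps_X_power_mult_nth)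
  also have "\<dots> = (T1 ^ i) $ (m - i)"
    by (rule fps_power_nth_cong) (simp add: H1_def T1_def)
  also have "\<dots> = (T ^ i) $ m"
    using assms(2) by (simp add: T power_mult_distrib fps_X_power_mult_nth)
  also have "\<dots> = fact i * ((fps_const (1 / fact i) * T ^ i) $ m)"
    by simp
  \<comment> \<open>Each multinomial term is a monomial of degree
    \<open>\<Sum>l\<in>S. l * j l\<close>; extracting coefficient \<open>m\<close> imposes the
    second constraint of the Bell sum.\<close>
  also have "(fps_const (1 / fact i) * T ^ i) $ m =
     (\<Sum>j | j \<in> S \<rightarrow>\<^sub>E (UNIV :: nat set) \<and> (\<Sum>l\<in>S. j l) = i.
       if (\<Sum>l\<in>S. l * j l) = m then (\<Prod>l\<in>S. (x l / fact l) ^ j l) / (\<Prod>l\<in>S. fact (j l)) else 0)"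
  proof -
    have "(\<Prod>l\<in>S. fps_const (1 / fact (j l)) * (fps_const (x l / fact l) * fps_X ^ l) ^ j l) =
       fps_const ((\<Prod>l\<in>S. (x l / fact l) ^ j l) / (\<Prod>l\<in>S. fact (j l))) * fps_X ^ (\<Sum>l\<in>S. l * j l)"
      for j :: "nat \<Rightarrow> nat"
    proof -
      have "(\<Prod>l\<in>S. fps_const (1 / fact (j l)) * (fps_const (x l / fact l) * fps_X ^ l) ^ j l) =
            (\<Prod>l\<in>S. fps_const ((x l / fact l) ^ j l / fact (j l)) * fps_X ^ (l * j l))"
        by (simp add: power_mult_distrib power_mult mult.assoc[symmetric] fps_const_power)
      also have "\<dots> = (\<Prod>l\<in>S. fps_const ((x l / fact l) ^ j l / fact (j l))) * (\<Prod>l\<in>S. fps_X ^ (l * j l))"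
        by (rule prod.distrib)
      also have "(\<Prod>l\<in>S. fps_const ((x l / fact l) ^ j l / fact (j l))) = 
          fps_const (\<Prod>l\<in>S. (x l / fact l) ^ j l / fact (j l))"
        by (induction S rule: infinite_finite_induct) (auto simp: fps_const_mult[symmetric] simp del: fps_const_mult)
      finally show ?thesis by (simp add: power_sum prod_dividef)
    qed
    then show ?thesis
      unfolding T_def by (subst fps_multinomial) (auto simp: S_def fps_sum_nth intro!: sum.cong)
  qed
  also have "\<dots> = (\<Sum>j | j \<in> S \<rightarrow>\<^sub>E (UNIV :: nat set) \<and> (\<Sum>l\<in>S. j l) = i \<and> (\<Sum>l\<in>S. l * j l) = m.
       (\<Prod>l\<in>S. (x l / fact l) ^ j l) / (\<Prod>l\<in>S. fact (j l)))"
    using finite_PiE_sum_eq[of S i] by (subst sum.inter_filter[symmetric]) (auto simp: S_def conj_ac)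
  also have "\<dots> = bell_poly m i x / fact m"
    by (simp add: bell_poly_def S_def sum_divide_distrib sum_distrib_left mult_ac)
  finally show ?thesis by simp
qed

lemma fps_inverse_nth_eq_bell_poly:
  fixes x :: "nat \<Rightarrow> real"
  assumes "x 0 = 1"
  shows "inverse (Abs_fps (\<lambda>m. x m / fact m)) $ m =
           (\<Sum>i = 0..m. (- 1) ^ i * fact i * bell_poly m i x) / fact m"
proof -
  define F where "F = Abs_fps (\<lambda>m. x m / fact m)"
  define H where "H = Abs_fps (\<lambda>m. if m = 0 then 0 else x m / fact m)"
  have F: "F = 1 + H" by (rule fps_ext) (auto simp: F_def H_def assms)
  have inv: "inverse F * F = 1"
    by (rule inverse_mult_eq_1) (simp add: F_def assms)
  \<comment> \<open>A finite geometric sum suffices: \<open>H\<close> has no constant term, so the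
    remainder \<open>(- H) ^ Suc m\<close> starts beyond degree \<open>m\<close>.\<close>
  have "1 - (- H) ^ Suc m = F * (\<Sum>i\<le>m. (- H) ^ i)"
    using one_diff_power_eq[of "- H" "Suc m"] by (simp add: F lessThan_Suc_atMost del: power_Suc)
  then have "(\<Sum>i\<le>m. (- H) ^ i) = inverse F * (1 - (- H) ^ Suc m)"
    using inv by (metis mult.assoc mult_1)
  then have "(\<Sum>i\<le>m. (- H) ^ i) $ m = inverse F $ m - (inverse F * (- H) ^ Suc m) $ m"
    by (simp add: algebra_simps)
  also have "(inverse F * (- H) ^ Suc m) $ m = 0"
    using startsby_zero_power_prefix[of "- H" "Suc m"]
    by (auto simp: fps_mult_nth[of "inverse F"] H_def intro!: sum.neutral)
  finally have "inverse F $ m = (\<Sum>i\<le>m. ((- H) ^ i) $ m)"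
    by (simp add: fps_sum_nth)
  also have "\<dots> = (\<Sum>i\<le>m. (- 1) ^ i * (fact i / fact m * bell_poly m i x))"
  proof (rule sum.cong, goal_cases)
    case (2 i)
    have "(- H) ^ i = fps_const ((- 1) ^ i) * H ^ i"
      by (subst power_minus) (simp flip: fps_const_power fps_const_neg)
    then show ?case 
      using 2 fps_power_nth_eq_bell_poly[of i m x] by (simp add: H_def)
  qed auto
  finally show ?thesis
    by (simp add: F_def sum_divide_distrib atLeast0AtMost mult_ac)
qed

section \<open>Complete monotonicity of the Mittag-Leffler function\<close>

text \<open>Polymorphic because the weights use the real function, the Appell generating function
  the complex one.\<close>

definition mittag_leffler_fps :: "real \<Rightarrow> 'a :: {banach, real_normed_field} fps" where
  "mittag_leffler_fps \<beta> = Abs_fps (\<lambda>n. of_real (rGamma (\<beta> * real n + 1)))"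

section \<open>Euler's product for 1/Gamma and its expansion in binomial coefficients\<close>

definition euler_approx :: "real \<Rightarrow> nat \<Rightarrow> real" where
  "euler_approx a N = pochhammer (a + 1) N / (fact N * real N powr a)"

text \<open>Compared with \<open>euler_approx a N\<close>, \<open>rGamma_series (a + 1) N\<close>
  has the extra factor \<open>(a + 1 + N) / N\<close>, which tends to 1.\<close>

lemma euler_approx_LIMSEQ:
  assumes "a \<ge> 0"
  shows "euler_approx a \<longlonglongrightarrow> rGamma (a + 1)"
proof -
  have "(\<lambda>N. real N / (a + 1 + real N)) \<longlonglongrightarrow> 1"
    by real_asymp
  then have "(\<lambda>N. rGamma_series (a + 1) N * (real N / (a + 1 + real N))) \<longlonglongrightarrow> rGamma (a + 1) * 1"
    by (intro tendsto_intros)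
  moreover have "\<forall>\<^sub>F N in sequentially.
      rGamma_series (a + 1) N * (real N / (a + 1 + real N)) = euler_approx a N"
    using eventually_gt_at_top[of 0]
  proof eventually_elim
    case (elim N)
    then have "exp ((a + 1) * ln (real N)) = real N powr a * real N"
      by (simp add: powr_def exp_add ring_distribs)
    moreover have "a + 1 + real N \<noteq> 0" using assms by simp
    ultimately show ?case using elim
      by (simp add: rGamma_series_def euler_approx_def pochhammer_Suc)
  qed
  ultimately show ?thesis by (simp add: Lim_transform_eventually)
qed

text \<open>The claim amounts to 1 + a/(N+1) being at most ((N+1)/N) powr a. This follows from 1 + y
  \<le> exp y and 1/(N+1) \<le> ln ((N+1)/N), the latter being ln y \<le> y - 1 at y =
  N/(N+1).\<close>

lemma euler_approx_Suc_le:
  assumes "a \<ge> 0" "N \<ge> 1"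
  shows "euler_approx a (Suc N) \<le> euler_approx a N"
proof -
  have "1 / (1 + real N) \<le> - ln (1 - 1 / (1 + real N))"
    using assms(2) ln_le_minus_one[of "1 - 1 / (1 + real N)"] by simp
  also have "\<dots> = ln (1 + real N) - ln (real N)"
  proof -
    have "1 - 1 / (1 + real N) = real N / (1 + real N)" by (simp add: field_simps)
    then show ?thesis using assms(2) by (simp add: ln_div)
  qed
  finally have "a * (1 / (1 + real N)) \<le> a * (ln (1 + real N) - ln (real N))"
    using assms(1) by (rule mult_left_mono)
  then have "1 + a / (1 + real N) \<le> exp (a * (ln (1 + real N) - ln (real N)))"
    using exp_ge_add_one_self[of "a * (ln (1 + real N) - ln (real N))"] by (simp only: times_divide_eq_right mult_1_right)
  also have "\<dots> = (1 + real N) powr a / real N powr a"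
    using assms(2) by (simp add: powr_def right_diff_distrib exp_diff)
  finally have "1 + a / (1 + real N) \<le> (1 + real N) powr a / real N powr a" .
  from divide_right_mono[OF this, of "(1 + real N) powr a"]
  have *: "(1 + a / (1 + real N)) / (1 + real N) powr a \<le> 1 / real N powr a"
    by simp
  have "euler_approx a (Suc N) =
      pochhammer (a + 1) N / fact N * ((1 + a / (1 + real N)) / (1 + real N) powr a)"
    by (simp add: euler_approx_def pochhammer_Suc divide_simps add_ac)
  also have "\<dots> \<le> pochhammer (a + 1) N / fact N * (1 / real N powr a)"
    using assms(1) by (intro mult_left_mono *) (auto intro!: divide_nonneg_pos pochhammer_nonneg)
  finally show ?thesis by (simp add: euler_approx_def)
qed

lemma euler_approx_antimono:
  assumes "a \<ge> 0" "1 \<le> M" "M \<le> N"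
  shows "euler_approx a N \<le> euler_approx a M"
  using assms(3)
proof (induction N rule: dec_induct)
  case (step N)
  then show ?case using euler_approx_Suc_le[OF assms(1), of N] assms(2) by linarith
qed auto

lemma euler_approx_nonneg: "a \<ge> 0 \<Longrightarrow> euler_approx a N \<ge> 0"
  by (auto simp: euler_approx_def intro!: divide_nonneg_nonneg pochhammer_nonneg mult_nonneg_nonneg)

text \<open>The weights are independent of \<open>n\<close>, so that after summation over
  \<open>n\<close> each \<open>j\<close> contributes one binomial series.\<close>

lemma pochhammer_eq_nonneg_combination:
  assumes "0 \<le> \<beta>" "\<beta> \<le> 1"
  shows "\<exists>b. (\<forall>j. b j \<ge> 0) \<and>
    (\<forall>n. pochhammer (\<beta> * real n + 1) N = (\<Sum>j\<le>N. b j * real ((n + j) choose j)))"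
proof (induction N)
  case 0
  show ?case by (intro exI[of _ "\<lambda>_. 1"]) auto
next
  case (Suc N)
  then obtain b where b: "\<And>j. b j \<ge> 0"
    "\<And>n. pochhammer (\<beta> * real n + 1) N = (\<Sum>j\<le>N. b j * real ((n + j) choose j))" by auto
  \<comment> \<open>Multiplying by \<beta> n + N + 1 leaves the factor N + 1 - \<beta> (j + 1) at
    index \<open>j\<close> and passes \<beta> (j + 1) on to index \<open>j + 1\<close>; seen from
    the receiving index, this is \<open>\<beta> * real j * b (j - 1)\<close>.\<close>
  define b' where "b' j = (if j \<le> N then (real N + 1 - \<beta> * (real j + 1)) * b j else 0) +
      (if j = 0 then 0 else \<beta> * real j * b (j - 1))" for j
  have "b' j \<ge> 0" for j
  proof -
    have "\<beta> * (real j + 1) \<le> real N + 1" if "j \<le> N"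
      using mult_mono[of \<beta> 1 "real j + 1" "real N + 1"] assms that by simp
    then show ?thesis using b(1) assms by (auto simp: b'_def intro!: add_nonneg_nonneg mult_nonneg_nonneg)
  qed
  moreover have "pochhammer (\<beta> * real n + 1) (Suc N) = (\<Sum>j\<le>Suc N. b' j * real ((n + j) choose j))" for n
  proof -
    \<comment> \<open>\<open>\<beta> n + N + 1 = \<beta> (n + j + 1) + (N + 1 - \<beta> (j + 1))\<close>, where \<open>\<beta> \<le> 1\<close> and \<open>j \<le> N\<close>
      make the last summand nonnegative.\<close>
    have step: "(\<beta> * real n + real N + 1) * real ((n + j) choose j) =
        (real N + 1 - \<beta> * (real j + 1)) * real ((n + j) choose j) +
        \<beta> * (real j + 1) * real ((n + Suc j) choose Suc j)" for j
    proof -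
      have "(real j + 1) * real ((n + Suc j) choose Suc j) = (real n + real j + 1) * real ((n + j) choose j)"
        using Suc_times_binomial_eq[of "n + j" j, THEN arg_cong[of _ _ real]]
        by (simp add: algebra_simps)
      then show ?thesis by (simp add: mult.assoc) (simp add: algebra_simps)
    qed
    have "pochhammer (\<beta> * real n + 1) (Suc N) =
        (\<Sum>j\<le>N. b j * ((\<beta> * real n + real N + 1) * real ((n + j) choose j)))"
      unfolding pochhammer_Suc b(2) sum_distrib_right by (intro sum.cong) (simp_all add: algebra_simps)
    also have "\<dots> = (\<Sum>j\<le>N. (real N + 1 - \<beta> * (real j + 1)) * b j * real ((n + j) choose j)) +
        (\<Sum>j\<le>N. \<beta> * real (Suc j) * b j * real ((n + Suc j) choose Suc j))"
      unfolding step by (simp add: sum.distrib[symmetric] ring_distribs mult_ac add_ac)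
    also have "(\<Sum>j\<le>N. (real N + 1 - \<beta> * (real j + 1)) * b j * real ((n + j) choose j)) =
        (\<Sum>j\<le>Suc N. (if j \<le> N then (real N + 1 - \<beta> * (real j + 1)) * b j else 0) * real ((n + j) choose j))"
      by simp
    also have "(\<Sum>j\<le>N. \<beta> * real (Suc j) * b j * real ((n + Suc j) choose Suc j)) =
        (\<Sum>j\<le>Suc N. (if j = 0 then 0 else \<beta> * real j * b (j - 1)) * real ((n + j) choose j))"
      by (subst sum.atMost_Suc_shift) (simp del: binomial_Suc_Suc)
    finally show ?thesis
      by (simp only: sum.distrib[symmetric] b'_def ring_distribs)
  qed
  ultimately show ?case by blast
qed

section \<open>Nonnegative approximating series and their limit\<close>

lemma binomial_series_sums:
  fixes w :: real
  assumes "\<bar>w\<bar> < 1"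
  shows "(\<lambda>n. real ((n + q) choose q) * w ^ n) sums (1 - w) powr (- real q - 1)"
proof -
  have "((- real q - 1) gchoose n) * (- w) ^ n = real ((n + q) choose q) * w ^ n" for n
  proof -
    have "(- real q - 1) gchoose n = (- 1) ^ n * (real (n + q) gchoose n)"
      by (subst gbinomial_negated_upper) (simp add: add_ac)
    also have "real (n + q) gchoose n = real ((n + q) choose q)"
      unfolding binomial_gbinomial[symmetric] using binomial_symmetric[of n "n + q"] by simp
    finally have "((- real q - 1) gchoose n) * (- w) ^ n =
        real ((n + q) choose q) * ((- 1) ^ n * (- w) ^ n)"
      by (simp only: mult_ac)
    then show ?thesis by (simp flip: power_mult_distrib)
  qed
  then show ?thesis
    using gen_binomial_real[of "- w" "- real q - 1"] assms by simp
qed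

text \<open>This is the k-th derivative of the approximating series, a nonnegative combination of
  powers of 1 - w. The sign of \<open>r\<close> is free: positive arguments supply a majorant,
  negative ones the nonnegativity of the limit.\<close>

lemma euler_approx_series_sums:
  assumes "0 \<le> \<beta>" "\<beta> \<le> 1" "N \<ge> 1" "\<bar>r\<bar> < real N powr \<beta>"
  shows "\<exists>s\<ge>0. (\<lambda>m. fact (m + k) / fact m * euler_approx (\<beta> * real (m + k)) N * r ^ m) sums s"
proof -
  obtain b where b: "\<And>j. b j \<ge> 0"
    "\<And>n. pochhammer (\<beta> * real n + 1) N = (\<Sum>j\<le>N. b j * real ((n + j) choose j))"
    using pochhammer_eq_nonneg_combination[OF assms(1,2)] by blast
  \<comment> \<open>The denominator \<open>fact N * N powr (\<beta> * (m + k))\<close> is split: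
    \<open>w\<close> absorbs the part depending on \<open>m\<close>, \<open>C\<close> the
    rest.\<close>
  define w where "w = r / real N powr \<beta>"
  define C where "C = fact N * real N powr (\<beta> * real k)"
  have w: "\<bar>w\<bar> < 1" using assms(3,4) by (simp add: w_def)
  have "(\<lambda>m. \<Sum>j\<le>N. b j * (fact (k + j) / fact j) / C * (real ((m + (k + j)) choose (k + j)) * w ^ m))
      sums (\<Sum>j\<le>N. b j * (fact (k + j) / fact j) / C * (1 - w) powr (- real (k + j) - 1))"
    by (intro sums_sum sums_mult binomial_series_sums w)
  moreover have "(\<Sum>j\<le>N. b j * (fact (k + j) / fact j) / C * (real ((m + (k + j)) choose (k + j)) * w ^ m)) =
      fact (m + k) / fact m * euler_approx (\<beta> * real (m + k)) N * r ^ m" for m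
  proof -
    have pw: "real N powr (\<beta> * real (m + k)) = real N powr (\<beta> * real k) * (real N powr \<beta>) ^ m"
      using assms(3) by (simp add: powr_power powr_add[symmetric] ring_distribs mult_ac add_ac)
    \<comment> \<open>Both sides equal (m + k + j)! / (m! j!).\<close>
    have *: "(fact (k + j) / fact j) * real ((m + (k + j)) choose (k + j)) =
        fact (m + k) / fact m * real (((m + k) + j) choose j)" for j
      by (simp add: binomial_fact add_ac)
    have "(\<Sum>j\<le>N. b j * (fact (k + j) / fact j) / C * (real ((m + (k + j)) choose (k + j)) * w ^ m)) =
       (\<Sum>j\<le>N. fact (m + k) / fact m * w ^ m / C * (b j * real (((m + k) + j) choose j)))"
    proof (intro sum.cong refl)
      fix j
      have "b j * (fact (k + j) / fact j) / C * (real ((m + (k + j)) choose (k + j)) * w ^ m) =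
          b j * w ^ m / C * ((fact (k + j) / fact j) * real ((m + (k + j)) choose (k + j)))"
        by (simp add: mult_ac)
      also have "\<dots> = fact (m + k) / fact m * w ^ m / C * (b j * real (((m + k) + j) choose j))"
        unfolding * by (simp add: mult_ac)
      finally show "b j * (fact (k + j) / fact j) / C * (real ((m + (k + j)) choose (k + j)) * w ^ m) = \<dots>" .
    qed
    also have "\<dots> = fact (m + k) / fact m * w ^ m / C * pochhammer (\<beta> * real (m + k) + 1) N"
      by (simp only: b(2) sum_distrib_left)
    also have "\<dots> = fact (m + k) / fact m * euler_approx (\<beta> * real (m + k)) N * r ^ m"
      by (simp only: euler_approx_def pw) (simp add: C_def w_def power_divide mult_ac)
    finally show ?thesis .
  qed
  moreover have "0 \<le> (\<Sum>j\<le>N. b j * (fact (k + j) / fact j) / C * (1 - w) powr (- real (k + j) - 1))"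
    using b(1) by (intro sum_nonneg mult_nonneg_nonneg divide_nonneg_nonneg) (auto simp: C_def)
  ultimately show ?thesis by auto
qed

lemma ex_nat_powr_gt:
  assumes "\<beta> > 0"
  shows "\<exists>N\<ge>1. \<forall>M\<ge>N. r < real M powr \<beta>"
proof -
  have "filterlim (\<lambda>N. real N powr \<beta>) at_top sequentially"
    using assms by real_asymp
  then have "\<forall>\<^sub>F N in sequentially. r < real N powr \<beta>"
    by (simp add: filterlim_at_top_dense)
  with eventually_ge_at_top[of 1] have "\<forall>\<^sub>F N in sequentially. 1 \<le> N \<and> r < real N powr \<beta>"
    by eventually_elim auto
  then show ?thesis
    unfolding eventually_sequentially by (meson order_refl)
qed

text \<open>Tannery's theorem as N grows. Since \<open>euler_approx\<close> decreases in N, the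
  series for a single \<open>N0\<close> with \<open>r < N0 powr \<beta>\<close> dominates all later
  ones; their sums at \<open>- r\<close> are nonnegative, and so is the limit.\<close>

lemma mittag_leffler_derivative_series:
  fixes k :: nat
  assumes "0 < \<beta>" "\<beta> \<le> 1" "r \<ge> 0"
  defines "b \<equiv> \<lambda>m. fact (m + k) / fact m * rGamma (\<beta> * real (m + k) + 1) * (- r) ^ m"
  shows "summable (\<lambda>m. norm (b m))" "suminf b \<ge> (0 :: real)"
proof -
  obtain N0 where N0: "N0 \<ge> 1" "\<And>N. N \<ge> N0 \<Longrightarrow> r < real N powr \<beta>"
    using ex_nat_powr_gt[OF assms(1)] by blast
  define a where "a m N = fact (m + k) / fact m * euler_approx (\<beta> * real (m + k)) N * (- r) ^ m" for m N
  define M where "M m = fact (m + k) / fact m * euler_approx (\<beta> * real (m + k)) N0 * r ^ m" for m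
  have nonneg: "0 \<le> \<beta> * real (m + k)" for m using assms(1) by simp
  have lim: "a m \<longlonglongrightarrow> b m" for m
    unfolding a_def b_def by (intro tendsto_intros euler_approx_LIMSEQ nonneg)
  have bound: "norm (a m N) \<le> M m" if "N \<ge> N0" for m N
  proof -
    have "norm (a m N) = fact (m + k) / fact m * euler_approx (\<beta> * real (m + k)) N * r ^ m"
      using assms(3) euler_approx_nonneg[OF nonneg] by (simp add: a_def abs_mult power_abs)
    also have "\<dots> \<le> M m"
      unfolding M_def using assms(3) that N0(1)
      by (intro mult_right_mono mult_left_mono euler_approx_antimono nonneg) auto
    finally show ?thesis .
  qed
  have "summable M"
    using euler_approx_series_sums[of \<beta> N0 r k] assms(1-3) N0
    by (auto simp: M_def[abs_def] sums_iff)
  moreover have "\<forall>\<^sub>F (m, N) in at_top \<times>\<^sub>F sequentially. norm (a m N) \<le> M m"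
    unfolding eventually_prod_sequentially using bound by auto
  ultimately have *: "summable (\<lambda>m. norm (b m))" "(\<lambda>N. \<Sum>m. a m N) \<longlonglongrightarrow> suminf b"
    using tannerys_theorem[of a b sequentially M, OF lim] by auto
  show "summable (\<lambda>m. norm (b m))" by fact
  have "(\<Sum>m. a m N) \<ge> 0" if "N \<ge> N0" for N
    using euler_approx_series_sums[of \<beta> N "- r" k] assms(1-3) N0 that
    by (auto simp: a_def[abs_def] sums_iff)
  then show "suminf b \<ge> 0"
    using *(2) by (intro tendsto_lowerbound[OF *(2)]) (auto simp: eventually_sequentially)
qed

section \<open>The Mittag-Leffler function as an entire function\<close>

text \<open>The case k = 0 of the domination argument already gives absolute convergence at every
  \<open>norm z\<close>.\<close>

lemma fps_conv_radius_mittag_leffler: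
  assumes "0 < \<beta>" "\<beta> \<le> 1"
  shows "fps_conv_radius (mittag_leffler_fps \<beta>) = \<infinity>"
  unfolding fps_conv_radius_def
proof (rule conv_radius_inftyI'')
  fix z :: 'a
  have "rGamma (\<beta> * real n + 1) \<ge> 0" for n
  proof -
    have "\<beta> * real n + 1 > 0" using assms by (intro add_nonneg_pos) auto
    then show ?thesis by (simp add: rGamma_inverse_Gamma Gamma_real_pos less_imp_le)
  qed
  then show "summable (\<lambda>n. fps_nth (mittag_leffler_fps \<beta>) n * z ^ n)"
    using mittag_leffler_derivative_series(1)[OF assms, of "norm z" 0]
    by (intro summable_norm_cancel[of "\<lambda>n. fps_nth (mittag_leffler_fps \<beta>) n * z ^ n"])
       (simp add: mittag_leffler_fps_def norm_mult norm_power abs_mult power_abs)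
qed

lemma mittag_leffler_eq_eval_fps: "mittag_leffler \<beta> = eval_fps (mittag_leffler_fps \<beta>)"
  by (simp add: fun_eq_iff mittag_leffler_def mittag_leffler_fps_def eval_fps_def
        rGamma_inverse_Gamma field_simps)

text \<open>One induction proves both claims: differentiating \<open>eval_fps\<close> at every point
  uses the infinite radius of the previous derivative.\<close>

lemma higher_deriv_eval_fps:
  fixes F :: "'a :: {banach, real_normed_field} fps"
  assumes "fps_conv_radius F = \<infinity>"
  shows "(deriv ^^ k) (eval_fps F) = eval_fps ((fps_deriv ^^ k) F)"
    and "fps_conv_radius ((fps_deriv ^^ k) F) = \<infinity>"
proof (induction k)
  case (Suc k)
  {
    case 1
    show ?case
      unfolding funpow.simps o_def Suc(1) by (rule ext) (simp add: eval_fps_deriv Suc(2))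
  next
    case 2
    then show ?case using Suc(2) fps_conv_radius_deriv[of "(fps_deriv ^^ k) F"] by simp
  }
qed (use assms in auto)

lemma fps_deriv_funpow_nth:
  fixes F :: "'a :: field_char_0 fps"
  shows "((fps_deriv ^^ k) F) $ m = fact (m + k) / fact m * F $ (m + k)"
proof (induction k arbitrary: m)
  case (Suc k)
  show ?case by (simp add: Suc field_simps del: of_nat_Suc)
qed auto

lemma higher_deriv_mittag_leffler_sums:
  fixes z :: "'a :: {banach, real_normed_field}"
  assumes "0 < \<beta>" "\<beta> \<le> 1"
  shows "(\<lambda>m. of_real (fact (m + k) / fact m * rGamma (\<beta> * real (m + k) + 1)) * z ^ m)
           sums (deriv ^^ k) (mittag_leffler \<beta>) z"
proof -
  note * = higher_deriv_eval_fps[OF fps_conv_radius_mittag_leffler[OF assms]]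
  have "(\<lambda>m. ((fps_deriv ^^ k) (mittag_leffler_fps \<beta>)) $ m * z ^ m)
      sums eval_fps ((fps_deriv ^^ k) (mittag_leffler_fps \<beta>)) z"
    by (rule sums_eval_fps) (simp add: *(2))
  then show ?thesis
    unfolding mittag_leffler_eq_eval_fps *(1)
    by (simp add: fps_deriv_funpow_nth mittag_leffler_fps_def)
qed

lemma higher_deriv_mittag_leffler_nonneg:
  fixes r :: real
  assumes "0 < \<beta>" "\<beta> \<le> 1" "r \<ge> 0"
  shows "(deriv ^^ k) (mittag_leffler \<beta>) (- r) \<ge> 0"
  using mittag_leffler_derivative_series(2)[OF assms, of k]
    higher_deriv_mittag_leffler_sums[OF assms(1,2), of k "- r"]
  by (simp add: sums_iff)

text \<open>Links the real derivatives in the weights to the complex Taylor coefficients: both are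
  sums of the same real series.\<close>

lemma higher_deriv_mittag_leffler_of_real:
  assumes "0 < \<beta>" "\<beta> \<le> 1"
  shows "(deriv ^^ k) (mittag_leffler \<beta>) (of_real r :: 'a :: {banach, real_normed_field}) =
     of_real ((deriv ^^ k) (mittag_leffler \<beta>) r)"
proof (rule sums_unique2)
  show "(\<lambda>m. of_real (fact (m + k) / fact m * rGamma (\<beta> * real (m + k) + 1)) * of_real r ^ m)
           sums (deriv ^^ k) (mittag_leffler \<beta>) (of_real r :: 'a)"
    by (rule higher_deriv_mittag_leffler_sums[OF assms])
  show "(\<lambda>m. of_real (fact (m + k) / fact m * rGamma (\<beta> * real (m + k) + 1)) * of_real r ^ m)
           sums (of_real ((deriv ^^ k) (mittag_leffler \<beta>) r) :: 'a)"
    using sums_of_real[OF higher_deriv_mittag_leffler_sums[OF assms, of k r], where 'a = 'a]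
    by simp
qed

section \<open>Moments and Appell polynomials\<close>

text \<open>Taylor expansion about \<open>- lam\<close> with increment \<open>lam * w\<close>; it is
  the probability generating function of the weights.\<close>

lemma mittag_leffler_taylor_sums:
  fixes w :: complex
  assumes "0 < \<beta>" "\<beta> \<le> 1"
  shows "(\<lambda>k. of_real (lam ^ k / fact k * (deriv ^^ k) (mittag_leffler \<beta>) (- lam)) * w ^ k)
           sums mittag_leffler \<beta> (of_real lam * (w - 1))"
proof -
  have "mittag_leffler \<beta> holomorphic_on ball (- of_real lam :: complex) (norm (of_real lam * w) + 1)"
    unfolding mittag_leffler_eq_eval_fps
    by (rule holomorphic_on_eval_fps) (simp add: fps_conv_radius_mittag_leffler[OF assms])
  then have "(\<lambda>k. (deriv ^^ k) (mittag_leffler \<beta>) (- of_real lam) / fact k *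
      (of_real lam * (w - 1) - (- of_real lam)) ^ k) sums mittag_leffler \<beta> (of_real lam * (w - 1))"
    by (rule holomorphic_power_series) (simp add: dist_norm norm_minus_commute algebra_simps)
  moreover have "(deriv ^^ k) (mittag_leffler \<beta>) (- of_real lam :: complex) =
      of_real ((deriv ^^ k) (mittag_leffler \<beta>) (- lam))" for k
    using higher_deriv_mittag_leffler_of_real[OF assms, of k "- lam", where 'a = complex] by simp
  ultimately show ?thesis
    by (simp add: power_mult_distrib algebra_simps)
qed

text \<open>Fubini for the double series of q k (k z)^n / n!: summing over n first gives the
  generating function at exp z, summing over k first gives the moments.\<close>

lemma frac_poisson_moment_sums:
  assumes "lam > 0" "0 < \<beta>" "\<beta> \<le> 1"
  shows "(\<lambda>n. z ^ n / fact n * of_real (frac_poisson_moment lam \<beta> n))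
           sums mittag_leffler \<beta> (of_real lam * (exp z - 1) :: complex)"
proof -
  define q where "q k = lam ^ k / fact k * (deriv ^^ k) (mittag_leffler \<beta>) (- lam)" for k
  have q_nonneg: "q k \<ge> 0" for k
    using assms higher_deriv_mittag_leffler_nonneg[OF assms(2,3), of lam k] by (simp add: q_def)
  have pgf: "(\<lambda>k. of_real (q k) * w ^ k) sums mittag_leffler \<beta> (of_real lam * (w - 1))" for w :: complex
    unfolding q_def by (rule mittag_leffler_taylor_sums[OF assms(2,3)])
  \<comment> \<open>At the real point \<open>exp r\<close> with r = \<open>norm z\<close>, this
    bounds the row sums of norms and makes the double family absolutely summable.\<close>
  have q_summable: "summable (\<lambda>k. q k * exp r ^ k)" for r :: real
    using sums_Re[OF pgf[of "of_real (exp r)"]] by (simp add: sums_iff flip: of_real_power)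

  define f where "f z = (\<lambda>(k, n). of_real (q k) * ((of_nat k * z) ^ n / fact n))" for z :: complex
  have row: "((\<lambda>n. f z (k, n)) has_sum (of_real (q k) * exp z ^ k)) UNIV" for z k
  proof -
    have "((\<lambda>n. (of_nat k * z) ^ n / fact n) has_sum exp (of_nat k * z)) UNIV"
      using exp_converges[of "of_nat k * z"] summable_norm_exp[of "of_nat k * z"]
      by (intro norm_summable_imp_has_sum) (simp_all add: scaleR_conv_of_real field_simps)
    then show ?thesis
      unfolding f_def exp_of_nat_mult prod.case by (rule has_sum_cmult_right)
  qed
  have row_norm: "((\<lambda>n. norm (f z (k, n))) has_sum (q k * exp (norm z) ^ k)) UNIV" for z k
  proof -
    have "(\<lambda>n. q k * ((real k * norm z) ^ n / fact n)) sums (q k * exp (real k * norm z))"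
      using exp_converges[of "real k * norm z"] by (intro sums_mult) (simp add: field_simps)
    then have "((\<lambda>n. q k * ((real k * norm z) ^ n / fact n)) has_sum (q k * exp (norm z) ^ k)) UNIV"
      unfolding exp_of_nat_mult using q_nonneg by (intro sums_nonneg_imp_has_sum) auto
    then show ?thesis
      using q_nonneg by (simp add: f_def norm_mult norm_divide norm_power)
  qed
  have f_abs_summable: "(\<lambda>p. norm (f z p)) summable_on UNIV \<times> UNIV" for z
  proof (rule summable_on_SigmaI[OF row_norm])
    show "(\<lambda>k. q k * exp (norm z) ^ k) summable_on UNIV"
      using q_summable q_nonneg by (subst summable_on_UNIV_nonneg_real_iff) auto
  qed auto
  have f_summable: "f z summable_on UNIV \<times> UNIV" for z
    using f_abs_summable by (rule abs_summable_summable)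

  have moment: "frac_poisson_moment lam \<beta> n = (\<Sum>k. q k * real k ^ n)"
    and moment_summable: "(\<lambda>k. q k * real k ^ n) summable_on UNIV" for n
  proof -
    \<comment> \<open>At z = 1, column \<open>n\<close> is \<open>q k * real k ^ n / fact n\<close>,
      so absolute summability yields finite moments.\<close>
    have "(\<lambda>k. norm (f 1 (k, n))) summable_on UNIV"
      using f_abs_summable[of 1, THEN summable_on_swap[THEN iffD1]]
        summable_on_SigmaD1[of "\<lambda>n k. norm (f 1 (k, n))" UNIV "\<lambda>_. UNIV" n] by simp
    then have "(\<lambda>k. fact n * norm (f 1 (k, n))) summable_on UNIV"
      by (rule summable_on_cmult_right)
    then show *: "(\<lambda>k. q k * real k ^ n) summable_on UNIV"
      using q_nonneg by (simp add: f_def norm_mult norm_divide norm_power)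
    have int: "integrable (count_space UNIV) (\<lambda>k. q k * real k ^ n)"
      using * q_nonneg 
      by (subst integrable_count_space_nat_iff) (simp add: summable_on_UNIV_nonneg_real_iff)
    have "frac_poisson_moment lam \<beta> n =
        (LINT k | density (count_space UNIV) (\<lambda>k. ennreal (q k)). real k ^ n)"
      unfolding frac_poisson_moment_def frac_poisson_def q_def by (subst integral_distr) auto
    \<comment> \<open>Nonnegative weights pass through \<open>ennreal\<close> unchanged.\<close>
    also have "\<dots> = (LINT k | count_space UNIV. q k * real k ^ n)"
      using q_nonneg by (subst integral_density) auto
    also have "\<dots> = (\<Sum>k. q k * real k ^ n)"
      by (rule integral_count_space_nat[OF int])
    finally show "frac_poisson_moment lam \<beta> n = (\<Sum>k. q k * real k ^ n)" .
  qed
  have column: "((\<lambda>k. f z (k, n)) has_sum (z ^ n / fact n * of_real (frac_poisson_moment lam \<beta> n))) UNIV"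
    for n
  proof -
    have "((\<lambda>k. q k * real k ^ n) has_sum frac_poisson_moment lam \<beta> n) UNIV"
      using has_sum_infsum[OF moment_summable[of n]]
        has_sum_imp_sums[OF has_sum_infsum[OF moment_summable[of n]]]
      by (simp add: moment sums_iff)
    then have "((\<lambda>k. z ^ n / fact n * of_real (q k * real k ^ n)) has_sum
        (z ^ n / fact n * of_real (frac_poisson_moment lam \<beta> n))) UNIV"
      by (intro has_sum_cmult_right has_sum_of_real)
    then show ?thesis
      by (simp add: f_def power_mult_distrib mult_ac)
  qed

  obtain S where S: "(f z has_sum S) (UNIV \<times> UNIV)"
    using f_summable by (auto simp: summable_on_def)
  have "(\<lambda>k. of_real (q k) * exp z ^ k) sums S"
    by (rule has_sum_imp_sums[OF has_sum_SigmaD[OF S row]])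
  then have "S = mittag_leffler \<beta> (of_real lam * (exp z - 1))"
    using pgf by (rule sums_unique2)
  moreover have "((\<lambda>(n, k). f z (k, n)) has_sum S) (UNIV \<times> UNIV)"
    using S by (subst (asm) has_sum_swap) simp
  then have "((\<lambda>n. z ^ n / fact n * of_real (frac_poisson_moment lam \<beta> n)) has_sum S) UNIV"
    by (rule has_sum_SigmaD) (simp only: prod.case column)
  ultimately show ?thesis by (simp add: has_sum_imp_sums)
qed

section \<open>Reciprocal series and the Appell coefficients\<close>

lemma fps_inverse_of_real:
  fixes f :: "nat \<Rightarrow> real"
  assumes "f 0 \<noteq> 0"
  shows "inverse (Abs_fps (\<lambda>n. of_real (f n) :: 'a :: real_normed_field)) =
           Abs_fps (\<lambda>n. of_real (inverse (Abs_fps f) $ n))"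
proof (rule fps_inverse_unique, rule fps_ext)
  fix n
  have "Abs_fps f * inverse (Abs_fps f) = 1"
    using assms by (intro inverse_mult_eq_1') simp
  then have "of_real ((Abs_fps f * inverse (Abs_fps f)) $ n) = (of_real (1 $ n) :: 'a)"
    by simp
  then show "(Abs_fps (\<lambda>n. of_real (f n)) * Abs_fps (\<lambda>n. of_real (inverse (Abs_fps f) $ n))) $ n =
      (1 :: 'a fps) $ n"
    by (simp add: fps_mult_nth)
qed

text \<open>Discharges the \<open>THE\<close> in \<open>appell\<close>: the expansion gives
  existence, uniqueness of Taylor coefficients and injectivity of \<open>of_real\<close> give
  uniqueness.\<close>

lemma powser_coeffs_eqI:
  fixes g :: "complex \<Rightarrow> complex" and a :: "nat \<Rightarrow> real"
  assumes "g has_fps_expansion Abs_fps (\<lambda>m. of_real (a m) / fact m)"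
  shows "(THE a :: nat \<Rightarrow> real. \<forall>\<^sub>F z in nhds 0. (\<lambda>m. z ^ m / fact m * of_real (a m)) sums g z) = a"
proof (rule the_equality)
  define F where "F a = Abs_fps (\<lambda>m. of_real (a m) / fact m :: complex)" for a :: "nat \<Rightarrow> real"
  have "\<forall>\<^sub>F z in nhds 0. z \<in> eball 0 (fps_conv_radius (F a))"
    using assms by (intro eventually_nhds_in_open) (auto simp: has_fps_expansion_def F_def zero_ereal_def)
  moreover have "\<forall>\<^sub>F z in nhds 0. eval_fps (F a) z = g z"
    using assms by (simp add: has_fps_expansion_def F_def)
  ultimately show "\<forall>\<^sub>F z in nhds 0. (\<lambda>m. z ^ m / fact m * of_real (a m)) sums g z"
  proof eventually_elim
    case (elim z)
    then show ?case
      using sums_eval_fps[of z "F a"] by (simp add: F_def mult_ac)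
  qed
next
  fix a' :: "nat \<Rightarrow> real"
  assume "\<forall>\<^sub>F z in nhds 0. (\<lambda>m. z ^ m / fact m * of_real (a' m)) sums g z"
  then have "g has_fps_expansion Abs_fps (\<lambda>m. of_real (a' m) / fact m)"
    by (intro has_fps_expansionI) (simp add: mult_ac)
  from fps_nth_fps_expansion[OF this] fps_nth_fps_expansion[OF assms]
  have "complex_of_real (a' m) / fact m = of_real (a m) / fact m" for m
    by simp
  then show "a' = a" by (simp add: fun_eq_iff)
qed

theorem theoremB12:
  fixes lam \<beta> x :: real and n :: nat
  assumes "lam > 0" and "\<beta> \<in> {0<..1}"
  shows "appell lam \<beta> n x =
    (\<Sum>k = 0..n. real (n choose k) *
       (\<Sum>i = 0..n - k. (- 1) ^ i * fact i *
          bell_poly (n - k) i (frac_poisson_moment lam \<beta>)) * x ^ k)"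
proof -
  define M where "M = frac_poisson_moment lam \<beta>"
  define L where "L z = mittag_leffler \<beta> (of_real lam * (exp z - 1))" for z :: complex
  define b where "b m = (\<Sum>i = 0..m. (- 1) ^ i * fact i * bell_poly m i M)" for m
  define a where "a m = (\<Sum>k = 0..m. real (m choose k) * b (m - k) * x ^ k)" for m
  have L_sums: "(\<lambda>n. z ^ n / fact n * of_real (M n)) sums L z" for z
    unfolding M_def L_def using assms by (intro frac_poisson_moment_sums) auto
  \<comment> \<open>The total mass, read off at z = 0; it makes the constant coefficient of L
    invertible.\<close>
  have "M 0 = 1"
  proof -
    have "L 0 = 1"
      by (simp add: L_def mittag_leffler_eq_eval_fps eval_fps_at_0 mittag_leffler_fps_def)
    then have "(\<lambda>n. of_real (M n) / fact n * 0 ^ n) sums (1 :: complex)"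
      using L_sums[of 0] by (simp add: mult_ac)
    from powser_sums_zero_iff[THEN iffD1, OF this] show ?thesis by simp
  qed
  have "L has_fps_expansion Abs_fps (\<lambda>n. of_real (M n / fact n))"
    using L_sums by (intro has_fps_expansionI always_eventually) (simp add: mult_ac)
  then have "(\<lambda>z. exp (of_real x * z) * inverse (L z)) has_fps_expansion
      fps_exp (of_real x) * inverse (Abs_fps (\<lambda>n. of_real (M n / fact n)))"
    by (intro has_fps_expansion_mult has_fps_expansion_exp has_fps_expansion_inverse)
       (simp_all add: \<open>M 0 = 1\<close>)
  also have "inverse (Abs_fps (\<lambda>n. of_real (M n / fact n))) =
      Abs_fps (\<lambda>m. of_real (b m / fact m) :: complex)"
    by (subst fps_inverse_of_real)
       (simp_all add: \<open>M 0 = 1\<close> fps_inverse_nth_eq_bell_poly b_def)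
  \<comment> \<open>The product of exponential generating functions is a binomial
    convolution.\<close>
  also have "fps_exp (of_real x) * \<dots> = Abs_fps (\<lambda>m. of_real (a m) / fact m)"
    by (rule fps_ext) (simp add: a_def fps_mult_nth sum_divide_distrib binomial_fact mult_ac)
  finally have "(\<lambda>z. exp (z * of_real x) / L z) has_fps_expansion Abs_fps (\<lambda>m. of_real (a m) / fact m)"
    by (simp add: divide_inverse mult_ac)
  then have "appell lam \<beta> n x = a n"
    unfolding appell_def L_def by (subst powser_coeffs_eqI) auto
  then show ?thesis by (simp add: a_def b_def M_def)
qed

end
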